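(* Let $(\Xi,\Theta,\Gamma)$ be a G-complete fuzzy metric space whose $t$-norm $\Gamma$ is of $\mathfrak{H}$-type and such that $\lim_{\rho\to\infty}\Theta(u,v,\rho)=1$ for all $u,v\in\Xi$. Let $\zeta\in\Pi$. If $S:\Xi\to K(\Xi)$ is a $\zeta$-contraction multi-valued mapping, then $S$ possesses a fixed point, i.e. there exists $u\in\Xi$ such that $u\in Su$.
   Context: $\mathbb{N}=\{0,1,2,\dots\}$. A $t$-norm is a binary operation $\Gamma:[0,1]\times[0,1]\to[0,1]$ that is commutative, associative, monotone ($\Gamma(\mu,\nu)\le\Gamma(\mu,w)$ whenever $\nu\le w$) and satisfies $\Gamma(\mu,1)=\Gamma(1,\mu)=\mu$ for all $\mu\in[0,1]$. For $\mu\in[0,1]$ put $\Gamma^0(\mu)=1$ and $\Gamma^n(\mu)=\Gamma(\Gamma^{n-1}(\mu),\mu)$ for $n\ge1$. The $t$-norm $\Gamma$ is of $\mathfrak{H}$-type if for every $\epsilon\in(0,1)$ there exists $\lambda\in(0,1)$ such that for $\rho\in[0,1]$, $\rho>1-\lambda$ implies $\Gamma^n(\rho)>1-\epsilon$ for all $n\ge1$. A fuzzy metric on a non-empty set $\Xi$ is a mapping $\Theta:\Xi\times\Xi\times(0,\infty)\to(0,1]$ such that for all $u,v\in\Xi$ and $\rho>0$: $\Theta(u,v,\rho)>0$; [$\Theta(u,v,\rho)=1$ if and only if $u=v$]; $\Theta(u,v,\rho)=\Theta(v,u,\rho)$. A fuzzy metric space (in the sense of George and Veeramani) is a triple $(\Xi,\Theta,\Gamma)$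 where $\Xi$ is a non-empty set, $\Theta$ is a fuzzy metric on $\Xi$, $\Gamma$ is a continuous $t$-norm, and for all $u,v,z\in\Xi$ and $\rho,s>0$: $\Theta(u,z,\rho+s)\ge\Gamma(\Theta(u,v,\rho),\Theta(v,z,s))$, and $\Theta(u,v,\cdot):(0,\infty)\to(0,1]$ is continuous. A sequence $\{x_n\}$ in $\Xi$ converges to $x\in\Xi$ if for all $\epsilon\in(0,1)$ and $\rho>0$ there exists $N\in\mathbb{N}$ such that $\Theta(x_n,x,\rho)>1-\epsilon$ whenever $n\ge N$. It is G-Cauchy if for every positive integer $p$, all $\epsilon\in(0,1)$ and all $\rho>0$, there exists $N\in\mathbb{N}$ such that $\Theta(x_n,x_{n+p},\rho)>1-\epsilon$ whenever $n\ge N$ (here $N$ may depend on $p$, $\epsilon$ and $\rho$). The space $(\Xi,\Theta,\Gamma)$ is G-complete if every G-Cauchy sequence converges to some $x\in\Xi$. The topology on $\Xi$ is the (metrizable) topology induced by the fuzzy metric, with basis the balls $\{y\in\Xi:\Theta(x,y,\rho)>1-\epsilon\}$, $x\in\Xi$, $\epsilon\in(0,1)$, $\rho>0$. $K(\Xi)$ denotes the set of all non-empty compact subsets of $\Xi$. For $v\in\Xi$, $A\in K(\Xi)$ and $\rho>0$, put $\Theta(v,A,\rho)=\Theta(A,v,\rho)=\sup_{u\in A}\Theta(v,u,\rho)$. The Hausdorff fuzzy metric is defined for $A,B\in K(\Xi)$ and $\rho>0$ by $$\Upsilon(A,B,\rho)=\min\Big\{\inf_{v\in B}\Theta(A,v,\rho),\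 \inf_{u\in A}\Theta(u,B,\rho)\Big\}.$$ $\Pi$ denotes the set of all functions $\zeta:(0,\infty)\to(0,\infty)$ such that $\lim_{n\to\infty}\zeta^n(\rho)=0$ for all $\rho>0$, where $\zeta^n$ is the $n$-th iterate of $\zeta$. A multi-valued mapping $S:\Xi\to K(\Xi)$ is a $\zeta$-contraction (with $\zeta\in\Pi$) if $\Upsilon(Su,Sv,\zeta(\rho))\ge\Theta(u,v,\rho)$ for all $u,v\in\Xi$ and $\rho>0$. *)

theory Defs
  imports "HOL-Analysis.Analysis"
begin

text \<open>
  Operations on the unit interval and functions on the positive reals are total functions on the
  reals of which only the values on the intended domain are constrained.
\<close>

locale t_norm =
  fixes T :: "real \<Rightarrow> real \<Rightarrow> real"
  assumes closed: "\<mu> \<in> {0..1} \<Longrightarrow> \<nu> \<in> {0..1} \<Longrightarrow> T \<mu> \<nu> \<in> {0..1}"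
    and commute: "\<mu> \<in> {0..1} \<Longrightarrow> \<nu> \<in> {0..1} \<Longrightarrow> T \<mu> \<nu> = T \<nu> \<mu>"
    and assoc: "\<mu> \<in> {0..1} \<Longrightarrow> \<nu> \<in> {0..1} \<Longrightarrow> w \<in> {0..1} \<Longrightarrow> T (T \<mu> \<nu>) w = T \<mu> (T \<nu> w)"
    and mono: "\<mu> \<in> {0..1} \<Longrightarrow> \<nu> \<in> {0..1} \<Longrightarrow> w \<in> {0..1} \<Longrightarrow> \<nu> \<le> w \<Longrightarrow> T \<mu> \<nu> \<le> T \<mu> w"
    and right_unit: "\<mu> \<in> {0..1} \<Longrightarrow> T \<mu> 1 = \<mu>"
    and left_unit: "\<mu> \<in> {0..1} \<Longrightarrow> T 1 \<mu> = \<mu>"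

primrec t_power :: "(real \<Rightarrow> real \<Rightarrow> real) \<Rightarrow> nat \<Rightarrow> real \<Rightarrow> real" where
  "t_power T 0 \<mu> = 1"
| "t_power T (Suc n) \<mu> = T (t_power T n \<mu>) \<mu>"

definition H_type :: "(real \<Rightarrow> real \<Rightarrow> real) \<Rightarrow> bool" where
  "H_type T \<longleftrightarrow> (\<forall>\<epsilon>\<in>{0<..<1}. \<exists>\<delta>\<in>{0<..<1}. \<forall>\<rho>\<in>{0..1}.
     \<rho> > 1 - \<delta> \<longrightarrow> (\<forall>n\<ge>1. t_power T n \<rho> > 1 - \<epsilon>))"

locale fuzzy_metric =
  fixes X :: "'a set" and M :: "'a \<Rightarrow> 'a \<Rightarrow> real \<Rightarrow> real"
  assumes nonempty: "X \<noteq> {}"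
    and positive: "u \<in> X \<Longrightarrow> v \<in> X \<Longrightarrow> \<rho> > 0 \<Longrightarrow> M u v \<rho> > 0"
    and le_one: "u \<in> X \<Longrightarrow> v \<in> X \<Longrightarrow> \<rho> > 0 \<Longrightarrow> M u v \<rho> \<le> 1"
    and eq_one_iff: "u \<in> X \<Longrightarrow> v \<in> X \<Longrightarrow> \<rho> > 0 \<Longrightarrow> M u v \<rho> = 1 \<longleftrightarrow> u = v"
    and sym: "u \<in> X \<Longrightarrow> v \<in> X \<Longrightarrow> \<rho> > 0 \<Longrightarrow> M u v \<rho> = M v u \<rho>"

locale fuzzy_metric_space = fuzzy_metric X M + t_norm T
  for X :: "'a set" and M :: "'a \<Rightarrow> 'a \<Rightarrow> real \<Rightarrow> real" and T :: "real \<Rightarrow> real \<Rightarrow> real" +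
  assumes continuous_t_norm: "continuous_on ({0..1} \<times> {0..1}) (\<lambda>(\<mu>, \<nu>). T \<mu> \<nu>)"
    and triangle: "u \<in> X \<Longrightarrow> v \<in> X \<Longrightarrow> z \<in> X \<Longrightarrow> \<rho> > 0 \<Longrightarrow> s > 0 \<Longrightarrow>
      M u z (\<rho> + s) \<ge> T (M u v \<rho>) (M v z s)"
    and continuous_metric: "u \<in> X \<Longrightarrow> v \<in> X \<Longrightarrow> continuous_on {0<..} (M u v)"

definition fm_converges ::
  "('a \<Rightarrow> 'a \<Rightarrow> real \<Rightarrow> real) \<Rightarrow> (nat \<Rightarrow> 'a) \<Rightarrow> 'a \<Rightarrow> bool" where
  "fm_converges M x l \<longleftrightarrow>
     (\<forall>\<epsilon>\<in>{0<..<1}. \<forall>\<rho>>0. \<exists>N. \<forall>n\<ge>N. M (x n) l \<rho> > 1 - \<epsilon>)"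

definition G_Cauchy :: "('a \<Rightarrow> 'a \<Rightarrow> real \<Rightarrow> real) \<Rightarrow> (nat \<Rightarrow> 'a) \<Rightarrow> bool" where
  "G_Cauchy M x \<longleftrightarrow>
     (\<forall>p\<ge>1. \<forall>\<epsilon>\<in>{0<..<1}. \<forall>\<rho>>0. \<exists>N. \<forall>n\<ge>N. M (x n) (x (n + p)) \<rho> > 1 - \<epsilon>)"

definition G_complete :: "'a set \<Rightarrow> ('a \<Rightarrow> 'a \<Rightarrow> real \<Rightarrow> real) \<Rightarrow> bool" where
  "G_complete X M \<longleftrightarrow>
     (\<forall>x. range x \<subseteq> X \<and> G_Cauchy M x \<longrightarrow> (\<exists>l\<in>X. fm_converges M x l))"

definition fm_ball ::
  "'a set \<Rightarrow> ('a \<Rightarrow> 'a \<Rightarrow> real \<Rightarrow> real) \<Rightarrow> 'a \<Rightarrow> real \<Rightarrow> real \<Rightarrow> 'a set" where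
  "fm_ball X M x \<epsilon> \<rho> = {y \<in> X. M x y \<rho> > 1 - \<epsilon>}"

text \<open>
  The balls are used as a subbasis here. In a fuzzy metric space they form a basis, as the lemma
  \<open>fuzzy_metric_space.openin_fm_topology\<close> below confirms.
\<close>

definition fm_topology :: "'a set \<Rightarrow> ('a \<Rightarrow> 'a \<Rightarrow> real \<Rightarrow> real) \<Rightarrow> 'a topology" where
  "fm_topology X M =
     topology_generated_by {fm_ball X M x \<epsilon> \<rho> |x \<epsilon> \<rho>. x \<in> X \<and> \<epsilon> \<in> {0<..<1} \<and> \<rho> > 0}"

definition fm_compacts :: "'a set \<Rightarrow> ('a \<Rightarrow> 'a \<Rightarrow> real \<Rightarrow> real) \<Rightarrow> 'a set set" where
  "fm_compacts X M = {A. A \<noteq> {} \<and> compactin (fm_topology X M) A}"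

definition fm_point_set ::
  "('a \<Rightarrow> 'a \<Rightarrow> real \<Rightarrow> real) \<Rightarrow> 'a \<Rightarrow> 'a set \<Rightarrow> real \<Rightarrow> real" where
  "fm_point_set M v A \<rho> = (SUP u\<in>A. M v u \<rho>)"

definition fm_Hausdorff ::
  "('a \<Rightarrow> 'a \<Rightarrow> real \<Rightarrow> real) \<Rightarrow> 'a set \<Rightarrow> 'a set \<Rightarrow> real \<Rightarrow> real" where
  "fm_Hausdorff M A B \<rho> =
     min (INF v\<in>B. fm_point_set M v A \<rho>) (INF u\<in>A. fm_point_set M u B \<rho>)"

definition Pi_class :: "(real \<Rightarrow> real) set" where
  "Pi_class = {\<zeta>. (\<forall>\<rho>>0. \<zeta> \<rho> > 0) \<and> (\<forall>\<rho>>0. (\<lambda>n. (\<zeta> ^^ n) \<rho>) \<longlonglongrightarrow> 0)}"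

definition zeta_contraction ::
  "'a set \<Rightarrow> ('a \<Rightarrow> 'a \<Rightarrow> real \<Rightarrow> real) \<Rightarrow> (real \<Rightarrow> real) \<Rightarrow> ('a \<Rightarrow> 'a set) \<Rightarrow> bool" where
  "zeta_contraction X M \<zeta> S \<longleftrightarrow>
     (\<forall>u\<in>X. \<forall>v\<in>X. \<forall>\<rho>>0. fm_Hausdorff M (S u) (S v) (\<zeta> \<rho>) \<ge> M u v \<rho>)"

context fuzzy_metric_space
begin

lemma metric_in_unit: "u \<in> X \<Longrightarrow> v \<in> X \<Longrightarrow> \<rho> > 0 \<Longrightarrow> M u v \<rho> \<in> {0..1}"
  using positive le_one by (simp add: less_imp_le)

lemma metric_mono:
  assumes "u \<in> X" "v \<in> X" "0 < \<rho>" "\<rho> \<le> s"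
  shows "M u v \<rho> \<le> M u v s"
proof (cases "\<rho> = s")
  case False
  then have "T (M u v \<rho>) (M v v (s - \<rho>)) \<le> M u v s"
    using triangle[of u v v \<rho> "s - \<rho>"] assms by simp
  moreover have "M v v (s - \<rho>) = 1"
    using eq_one_iff[of v v "s - \<rho>"] assms False by simp
  ultimately show ?thesis
    using right_unit[OF metric_in_unit] assms by simp
qed simp

lemma ball_contains_ball:
  assumes x: "x \<in> X" and "\<rho> > 0" and y: "y \<in> fm_ball X M x \<epsilon> \<rho>"
  shows "\<exists>\<delta>\<in>{0<..<1}. \<exists>s>0. fm_ball X M y \<delta> s \<subseteq> fm_ball X M x \<epsilon> \<rho>"
proof -
  have yX: "y \<in> X" and yM: "M x y \<rho> > 1 - \<epsilon>"
    using y by (auto simp: fm_ball_def)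
  have "isCont (M x y) \<rho>"
    using continuous_metric[OF x yX] \<open>\<rho> > 0\<close>
    by (simp add: continuous_on_eq_continuous_at)
  then have "\<forall>\<^sub>F r in at \<rho>. M x y r > 1 - \<epsilon>"
    using yM by (intro order_tendstoD(1)) (auto simp: isCont_def)
  then obtain d where d: "d > 0" "\<And>r. r \<noteq> \<rho> \<Longrightarrow> dist r \<rho> < d \<Longrightarrow> M x y r > 1 - \<epsilon>"
    by (auto simp: eventually_at)
  define r where "r = \<rho> - min (d / 2) (\<rho> / 2)"
  have r: "0 < r" "r < \<rho>" "dist r \<rho> < d"
    using d(1) \<open>\<rho> > 0\<close> by (auto simp: r_def dist_real_def min_def)
  define a where "a = M x y r"
  have a: "a > 1 - \<epsilon>" "a \<in> {0..1}"
    using d(2)[of r] r metric_in_unit[OF x yX] by (auto simp: a_def)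
  have "continuous_on {0..1} (\<lambda>b. (\<lambda>(\<mu>, \<nu>). T \<mu> \<nu>) (a, b))"
    by (rule continuous_on_compose2[OF continuous_t_norm])
       (use a in \<open>auto intro!: continuous_intros\<close>)
  then have "((\<lambda>b. T a b) \<longlongrightarrow> T a 1) (at 1 within {0..1})"
    by (auto simp: continuous_on_def)
  then have "\<forall>\<^sub>F b in at 1 within {0..1}. T a b > 1 - \<epsilon>"
    using a right_unit by (intro order_tendstoD(1)) auto
  then obtain e where e: "e > 0"
      "\<And>b. b \<in> {0..1} \<Longrightarrow> b \<noteq> 1 \<Longrightarrow> dist b 1 < e \<Longrightarrow> T a b > 1 - \<epsilon>"
    by (auto simp: eventually_at)
  define \<delta> where "\<delta> = min e (1 / 2)"
  have \<delta>: "\<delta> \<in> {0<..<1}" "\<delta> \<le> e"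
    using e(1) by (auto simp: \<delta>_def)
  have "z \<in> fm_ball X M x \<epsilon> \<rho>" if z: "z \<in> fm_ball X M y \<delta> (\<rho> - r)" for z
  proof -
    have zX: "z \<in> X" and zM: "M y z (\<rho> - r) > 1 - \<delta>"
      using z by (auto simp: fm_ball_def)
    have b: "M y z (\<rho> - r) \<in> {0..1}"
      using metric_in_unit[OF yX zX] r by simp
    have "T a (M y z (\<rho> - r)) > 1 - \<epsilon>"
    proof (cases "M y z (\<rho> - r) = 1")
      case True
      then show ?thesis using a right_unit by simp
    next
      case False
      then show ?thesis
        using e(2)[OF b] zM b \<delta> by (simp add: dist_real_def)
    qed
    also have "T a (M y z (\<rho> - r)) \<le> M x z \<rho>"
      using triangle[OF x yX zX, of r "\<rho> - r"] r by (simp add: a_def)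
    finally show ?thesis
      using zX by (simp add: fm_ball_def)
  qed
  then show ?thesis
    using \<delta> r by (intro bexI[of _ \<delta>] exI[of _ "\<rho> - r"]) auto
qed

lemma openin_fm_topology:
  "openin (fm_topology X M) U \<longleftrightarrow>
     U \<subseteq> X \<and> (\<forall>x\<in>U. \<exists>\<epsilon>\<in>{0<..<1}. \<exists>\<rho>>0. fm_ball X M x \<epsilon> \<rho> \<subseteq> U)"
  (is "_ \<longleftrightarrow> ?P U")
proof
  assume "openin (fm_topology X M) U"
  then have "generate_topology_on
      {fm_ball X M x \<epsilon> \<rho> |x \<epsilon> \<rho>. x \<in> X \<and> \<epsilon> \<in> {0<..<1} \<and> \<rho> > 0} U"
    by (simp add: fm_topology_def openin_topology_generated_by_iff)
  then show "?P U"
  proof induction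
    case Empty
    then show ?case by simp
  next
    case (Int A B)
    have "\<exists>\<epsilon>\<in>{0<..<1}. \<exists>\<rho>>0. fm_ball X M x \<epsilon> \<rho> \<subseteq> A \<inter> B" if x: "x \<in> A \<inter> B" for x
    proof -
      obtain e r where 1: "e \<in> {0<..<1}" "r > 0" "fm_ball X M x e r \<subseteq> A"
        using Int.IH(1) x by blast
      obtain f s where 2: "f \<in> {0<..<1}" "s > 0" "fm_ball X M x f s \<subseteq> B"
        using Int.IH(2) x by blast
      have xX: "x \<in> X"
        using Int.IH(1) x by blast
      have "fm_ball X M x (min e f) (min r s) \<subseteq> fm_ball X M x e r \<inter> fm_ball X M x f s"
      proof
        fix y assume y: "y \<in> fm_ball X M x (min e f) (min r s)"
        then have "y \<in> X" by (simp add: fm_ball_def)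
        then have "M x y (min r s) \<le> M x y r" "M x y (min r s) \<le> M x y s"
          using metric_mono[OF xX] 1(2) 2(2) by auto
        then show "y \<in> fm_ball X M x e r \<inter> fm_ball X M x f s"
          using y by (auto simp: fm_ball_def)
      qed
      then show ?thesis
        using 1 2 by (intro bexI[of _ "min e f"] exI[of _ "min r s"]) auto
    qed
    then show ?case
      using Int.IH by blast
  next
    case (UN K)
    then show ?case by (meson Sup_least Union_iff Union_upper order_trans)
  next
    case (Basis B)
    then obtain x \<epsilon> \<rho> where B: "B = fm_ball X M x \<epsilon> \<rho>" "x \<in> X" "\<rho> > 0"
      by auto
    then show ?case
      using ball_contains_ball[of x \<rho> _ \<epsilon>] by (auto simp: fm_ball_def)
  qed
next
  assume U: "?P U"
  have "\<exists>V. openin (fm_topology X M) V \<and> x \<in> V \<and> V \<subseteq> U" if x: "x \<in> U" for x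
  proof -
    obtain \<epsilon> \<rho> where *: "\<epsilon> \<in> {0<..<1}" "\<rho> > 0" "fm_ball X M x \<epsilon> \<rho> \<subseteq> U"
      using U x by blast
    have xX: "x \<in> X" using U x by blast
    have "openin (fm_topology X M) (fm_ball X M x \<epsilon> \<rho>)"
      unfolding fm_topology_def using * xX by (intro topology_generated_by_Basis) blast
    moreover have "x \<in> fm_ball X M x \<epsilon> \<rho>"
      using eq_one_iff[OF xX xX *(2)] xX * by (simp add: fm_ball_def)
    ultimately show ?thesis
      using * by blast
  qed
  then show "openin (fm_topology X M) U"
    by (subst openin_subopen) blast
qed

lemma topspace_fm_topology: "topspace (fm_topology X M) = X"
proof -
  have "\<exists>\<epsilon>\<in>{0<..<1}. \<exists>\<rho>>0. fm_ball X M x \<epsilon> \<rho> \<subseteq> X" for x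
    by (rule bexI[of _ "1 / 2"], rule exI[of _ 1]) (auto simp: fm_ball_def)
  then have "openin (fm_topology X M) X"
    by (simp add: openin_fm_topology)
  moreover have "topspace (fm_topology X M) \<subseteq> X"
    using openin_fm_topology openin_topspace by blast
  ultimately show ?thesis
    by (simp add: openin_subset subset_antisym)
qed

end

end

theory Submission
  imports Defs
begin

text \<open>
  The obvious attempt is to build one orbit \<open>x (n + 1) \<in> S (x n)\<close> whose consecutive distances
  contract at every scale. It breaks down: the Hausdorff condition provides, for each scale \<open>\<rho>\<close>
  separately, a point of the next value that is close enough at that scale, and points chosen for
  different scales need not agree. The proof instead finds, for each threshold \<open>b < 1\<close> and each
  scale \<open>s\<close> separately, points that are nearly fixed for \<open>(b, s)\<close>, and passes to a limit of those
  by a compactness argument.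

  Closeness is measured by chains: \<open>chained b \<rho> u v\<close> says that \<open>u\<close> and \<open>v\<close> are joined by finitely
  many steps with \<open>M > b\<close> at scale \<open>\<rho>\<close>. For each \<open>(b, \<rho>)\<close> this is an equivalence relation with
  open classes, so the relations behave like the balls of an ultrametric. Three facts make them
  useful. A G-Cauchy sequence is one whose consecutive terms become arbitrarily close; hence,
  filling in the chains, every sequence with \<open>x n\<close> and \<open>x (n + 1)\<close> chained at levels that tighten
  with \<open>n\<close> converges (\<open>chained_sequence_converges\<close>). Applied to \<open>u, v, u, v, \<dots>\<close>, this shows that
  points chained at every level are equal (\<open>chained_separated\<close>). And the contraction carries
  chains to chains: if \<open>u\<close> and \<open>v\<close> are chained at scale \<open>\<rho>\<close>, then every point of \<open>S u\<close> is chained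
  at scale \<open>\<zeta> \<rho>\<close> to a point of \<open>S v\<close> (\<open>chained_contraction\<close>).

  Call \<open>p\<close> near-fixed for \<open>(b, s)\<close> if it is chained at \<open>(b, s)\<close> to a point of \<open>S p\<close>. For a single
  \<open>b\<close> an orbit can be chosen, so near-fixed points exist (\<open>near_fixed_nonempty\<close>). The key point is
  that the set of all near-fixed points for \<open>(b, s)\<close> meets only finitely many chain classes
  (\<open>near_fixed_finite_net\<close>). Indeed, fix any \<open>u\<close>; by transitivity of chains all near-fixed points
  lie within one common scale \<open>c\<close> of \<open>u\<close>, and a near-fixed point is chained to its image at scale \<open>s\<close>, so for
  the first \<open>n\<close> with \<open>\<zeta>\<^sup>n c \<le> s\<close> it is chained at scale \<open>s\<close> to some point of the \<open>n\<close>-th image of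
  \<open>{u}\<close>. The number \<open>n\<close> is the same for all near-fixed points, and the \<open>n\<close>-th image of \<open>{u}\<close> is
  precompact because the values of \<open>S\<close> are compact.

  The near-fixed sets shrink as the level tightens. Given one near-fixed point for each level, the
  pigeonhole principle and a diagonal choice yield a sequence of them with consecutive terms
  chained at tightening levels. It converges to a point \<open>l\<close> that is near-fixed at every level.
  Compactness of \<open>S l\<close> and separation by chains then give \<open>l \<in> S l\<close>.
\<close>

section \<open>Interpolating a sequence of chains\<close>

text \<open>
  Concatenating chains from \<open>x n\<close> to \<open>x (n + 1)\<close> gives a sequence with small steps that has \<open>x\<close>
  as a subsequence; the \<open>n\<close>-th chain occupies the positions from \<open>k n\<close> to \<open>k (n + 1)\<close>.
\<close>

lemma interpolate_chains:
  fixes R :: "nat \<Rightarrow> 'a \<Rightarrow> 'a \<Rightarrow> bool"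
  assumes chain: "\<And>n. (R n)\<^sup>*\<^sup>* (x n) (x (Suc n))"
    and refl: "\<And>n. R n (x (Suc n)) (x (Suc n))"
    and anti: "\<And>n a b. R (Suc n) a b \<Longrightarrow> R n a b"
  obtains z and k :: "nat \<Rightarrow> nat"
  where "strict_mono k" "\<And>n. z (k n) = x n" "\<And>n i. k n \<le> i \<Longrightarrow> R n (z i) (z (Suc i))"
proof -
  have "\<exists>f l. 0 < l \<and> f 0 = x n \<and> f l = x (Suc n) \<and> (\<forall>i<l. R n (f i) (f (Suc i)))" for n
  proof -
    obtain m where "(R n ^^ m) (x n) (x (Suc n))"
      using chain[of n] by (auto simp: rtranclp_power)
    \<comment> \<open>Staying once at the end makes every chain nonempty, so that \<open>k\<close> is strictly increasing.\<close>
    then have "(R n ^^ Suc m) (x n) (x (Suc n))"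
      using refl[of n] by auto
    then show ?thesis
      unfolding relpowp_fun_conv by blast
  qed
  then obtain f l where l: "\<And>n. 0 < l n" and f0: "\<And>n. f n 0 = x n"
    and fl: "\<And>n. f n (l n) = x (Suc n)"
    and step: "\<And>n i. i < l n \<Longrightarrow> R n (f n i) (f n (Suc i))"
    by metis
  define k where "k n = (\<Sum>j<n. l j)" for n
  have k_Suc: "k (Suc n) = k n + l n" for n
    by (simp add: k_def)
  have mono_k: "strict_mono k"
    by (simp add: strict_mono_Suc_iff k_Suc l)
  define idx where "idx i = (LEAST n. i < k (Suc n))" for i
  define z where "z i = f (idx i) (i - k (idx i))" for i
  have idx_upper: "i < k (Suc (idx i))" for i
    unfolding idx_def
    by (rule LeastI[of _ i]) (meson Suc_le_lessD mono_k strict_mono_imp_increasing)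
  have idx_lower: "k (idx i) \<le> i" for i
  proof (cases "idx i")
    case 0
    then show ?thesis by (simp add: k_def)
  next
    case (Suc n)
    then have "\<not> i < k (Suc n)"
      unfolding idx_def by (metis lessI not_less_Least)
    then show ?thesis using Suc by simp
  qed
  have idx_eq: "idx i = n" if "k n \<le> i" "i < k (Suc n)" for n i
  proof (rule antisym)
    show "idx i \<le> n"
      unfolding idx_def using that(2) by (rule Least_le)
    have "k n < k (Suc (idx i))"
      using that(1) idx_upper[of i] by simp
    then show "n \<le> idx i"
      using mono_k by (simp add: strict_mono_less)
  qed
  have z_k: "z (k n) = x n" for n
    using idx_eq[of n "k n"] l[of n] by (simp add: z_def k_Suc f0)
  have z_step: "R (idx i) (z i) (z (Suc i))" for i
  proof -
    have lt: "i - k (idx i) < l (idx i)"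
      using idx_upper[of i] idx_lower[of i] by (simp add: k_Suc)
    have "z (Suc i) = f (idx i) (Suc (i - k (idx i)))"
    proof (cases "Suc i < k (Suc (idx i))")
      case True
      then have "idx (Suc i) = idx i"
        using idx_lower[of i] by (intro idx_eq) auto
      then show ?thesis
        using idx_lower[of i] by (simp add: z_def Suc_diff_le)
    next
      case False
      then have *: "Suc i = k (Suc (idx i))"
        using idx_upper[of i] by simp
      then have "Suc (i - k (idx i)) = l (idx i)"
        using idx_lower[of i] by (simp add: k_Suc)
      then show ?thesis
        using * z_k[of "Suc (idx i)"] fl by simp
    qed
    then show ?thesis
      using step[OF lt] by (simp add: z_def)
  qed
  have anti': "R m a b \<Longrightarrow> n \<le> m \<Longrightarrow> R n a b" for m n a b
    by (rule inc_induct[of n m "\<lambda>n. R n a b"]) (auto intro: anti)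
  have "R n (z i) (z (Suc i))" if "k n \<le> i" for n i
  proof (rule anti'[OF z_step])
    have "k n < k (Suc (idx i))"
      using that idx_upper[of i] by simp
    then show "n \<le> idx i"
      using mono_k by (simp add: strict_mono_less)
  qed
  then show thesis
    using that mono_k z_k by blast
qed

section \<open>Chain equivalence in a fuzzy metric space\<close>

context fuzzy_metric_space
begin

definition chained :: "real \<Rightarrow> real \<Rightarrow> 'a \<Rightarrow> 'a \<Rightarrow> bool" where
  "chained b \<rho> = (\<lambda>u v. u \<in> X \<and> v \<in> X \<and> M u v \<rho> > b)\<^sup>*\<^sup>*"

text \<open>
  A sequence of tolerances decreasing to 0 strictly inside the unit interval. One number serves both
  as the gap between the threshold and 1 and as the scale.
\<close>

definition level :: "nat \<Rightarrow> real" where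
  "level n = 1 / real (n + 2)"

definition chained_level :: "nat \<Rightarrow> 'a \<Rightarrow> 'a \<Rightarrow> bool" where
  "chained_level n = chained (1 - level n) (level n)"

lemma level_bounds: "0 < level n" "level n < 1"
  by (simp_all add: level_def)

lemma level_antimono: "m \<le> n \<Longrightarrow> level n \<le> level m"
  by (simp add: level_def frac_le)

lemma level_tendsto_0: "level \<longlonglongrightarrow> 0"
  unfolding level_def[abs_def]
  by (rule LIMSEQ_ignore_initial_segment[OF lim_1_over_n])

lemma level_eventually_less: "0 < e \<Longrightarrow> \<forall>\<^sub>F n in sequentially. level n < e"
  by (rule order_tendstoD(2)[OF level_tendsto_0])

lemma chained_refl [simp]: "chained b \<rho> u u"
  by (simp add: chained_def)

lemma chained_step: "u \<in> X \<Longrightarrow> v \<in> X \<Longrightarrow> M u v \<rho> > b \<Longrightarrow> chained b \<rho> u v"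
  by (auto simp: chained_def)

lemma chained_trans: "chained b \<rho> u v \<Longrightarrow> chained b \<rho> v w \<Longrightarrow> chained b \<rho> u w"
  by (auto simp: chained_def)

lemma chained_sym: "0 < \<rho> \<Longrightarrow> chained b \<rho> u v \<Longrightarrow> chained b \<rho> v u"
  unfolding chained_def
  by (rule sympD[OF symp_rtranclp]) (auto intro!: sympI simp: sym)

lemma chained_mono:
  assumes "chained b \<rho> u v" "0 < \<rho>" "\<rho> \<le> s" "c \<le> b"
  shows "chained c s u v"
proof -
  have "M u v s > c" if "u \<in> X \<and> v \<in> X \<and> M u v \<rho> > b" for u v
    using metric_mono[of u v \<rho> s] that assms by linarith
  then have "(\<lambda>u v. u \<in> X \<and> v \<in> X \<and> M u v \<rho> > b) \<le> (\<lambda>u v. u \<in> X \<and> v \<in> X \<and> M u v s > c)"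
    by auto
  then show ?thesis
    using assms(1) rtranclp_mono unfolding chained_def by blast
qed

lemma chained_level_mono: "chained_level n u v \<Longrightarrow> m \<le> n \<Longrightarrow> chained_level m u v"
  unfolding chained_level_def
  by (erule chained_mono) (auto simp: level_bounds level_antimono)

lemma chained_level_sym: "chained_level n u v \<Longrightarrow> chained_level n v u"
  unfolding chained_level_def by (rule chained_sym[OF level_bounds(1)])

lemma chained_level_trans:
  "chained_level n u v \<Longrightarrow> chained_level n v w \<Longrightarrow> chained_level n u w"
  unfolding chained_level_def by (rule chained_trans)

lemma metric_refl: "u \<in> X \<Longrightarrow> 0 < \<rho> \<Longrightarrow> M u u \<rho> = 1"
  by (simp add: eq_one_iff)

text \<open>
  If \<open>w\<close> lies in the ball of \<open>v\<close> given by \<open>(b, \<rho>)\<close>, then \<open>v\<close> and \<open>w\<close> are joined by a single step.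
  So every union of chain classes contains a ball around each of its points.
\<close>

lemma openin_chained_class:
  assumes "b \<in> {0<..<1}" "0 < \<rho>"
  shows "openin (fm_topology X M) {v \<in> X. chained b \<rho> u v}"
    and "openin (fm_topology X M) {v \<in> X. \<not> chained b \<rho> u v}"
proof -
  have ball: "chained b \<rho> v w" "w \<in> X" if "v \<in> X" "w \<in> fm_ball X M v (1 - b) \<rho>" for v w
    using that by (auto simp: fm_ball_def intro: chained_step)
  have b: "1 - b \<in> {0<..<1}"
    using assms by auto
  have "\<exists>\<epsilon>\<in>{0<..<1}. \<exists>\<rho>>0. fm_ball X M v \<epsilon> \<rho> \<subseteq> {v \<in> X. chained b \<rho>' u v}"
    if "v \<in> X" "chained b \<rho>' u v" "\<rho>' = \<rho>" for v \<rho>'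
    using that ball[OF that(1)] assms
    by (intro bexI[OF _ b] exI[of _ \<rho>]) (auto intro: chained_trans)
  then show "openin (fm_topology X M) {v \<in> X. chained b \<rho> u v}"
    unfolding openin_fm_topology by blast
  have "\<exists>\<epsilon>\<in>{0<..<1}. \<exists>\<rho>>0. fm_ball X M v \<epsilon> \<rho> \<subseteq> {v \<in> X. \<not> chained b \<rho>' u v}"
    if "v \<in> X" "\<not> chained b \<rho>' u v" "\<rho>' = \<rho>" for v \<rho>'
    using that ball[OF that(1)] assms
    by (intro bexI[OF _ b] exI[of _ \<rho>]) (auto dest: chained_sym intro: chained_trans)
  then show "openin (fm_topology X M) {v \<in> X. \<not> chained b \<rho> u v}"
    unfolding openin_fm_topology by blast
qed

lemma compactin_chained_net:
  assumes A: "compactin (fm_topology X M) A" and b: "b \<in> {0<..<1}" and "0 < \<rho>"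
  shows "\<exists>F. finite F \<and> F \<subseteq> A \<and> (\<forall>x\<in>A. \<exists>y\<in>F. chained b \<rho> y x)"
proof -
  have "A \<subseteq> X"
    using compactin_subset_topspace[OF A] topspace_fm_topology by simp
  let ?C = "\<lambda>u. {v \<in> X. chained b \<rho> u v}"
  have "A \<subseteq> \<Union> (?C ` A)"
    using \<open>A \<subseteq> X\<close> by auto
  then obtain \<F> where "finite \<F>" "\<F> \<subseteq> ?C ` A" "A \<subseteq> \<Union> \<F>"
    using compactinD[OF A, of "?C ` A"] openin_chained_class(1)[OF b \<open>0 < \<rho>\<close>] by blast
  then obtain F where "F \<subseteq> A" "finite F" "\<F> = ?C ` F"
    by (meson finite_subset_image)
  then show ?thesis
    using \<open>A \<subseteq> \<Union> \<F>\<close> by (intro exI[of _ F]) blast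
qed

text \<open>
  In the definition of G-Cauchy sequences the bound may depend on the gap \<open>p\<close>. So the triangle
  inequality, used a fixed number of times, reduces every gap to the gap 1 by continuity of the
  t-norm at \<open>(1, 1)\<close>.
\<close>

lemma G_Cauchy_of_consecutive:
  assumes x: "\<And>n. x n \<in> X"
    and lim: "\<And>\<rho>. 0 < \<rho> \<Longrightarrow> (\<lambda>n. M (x n) (x (Suc n)) \<rho>) \<longlonglongrightarrow> 1"
  shows "G_Cauchy M x"
proof -
  have conv: "(\<lambda>n. M (x n) (x (n + p)) \<rho>) \<longlonglongrightarrow> 1" if "0 < \<rho>" for p \<rho>
    using that
  proof (induction p arbitrary: \<rho>)
    case 0
    then show ?case by (simp add: metric_refl x)
  next
    case (Suc p)
    let ?a = "\<lambda>n. M (x n) (x (n + p)) (\<rho> / 2)"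
    let ?b = "\<lambda>n. M (x (n + p)) (x (Suc (n + p))) (\<rho> / 2)"
    have "?a \<longlonglongrightarrow> 1" "?b \<longlonglongrightarrow> 1"
      using Suc.IH[of "\<rho> / 2"] LIMSEQ_ignore_initial_segment[OF lim[of "\<rho> / 2"], of p] Suc.prems
      by auto
    then have "(\<lambda>n. (?a n, ?b n)) \<longlonglongrightarrow> (1, 1)"
      by (rule tendsto_Pair)
    then have "(\<lambda>n. (\<lambda>(\<mu>, \<nu>). T \<mu> \<nu>) (?a n, ?b n)) \<longlonglongrightarrow> (\<lambda>(\<mu>, \<nu>). T \<mu> \<nu>) (1, 1)"
      by (rule continuous_on_tendsto_compose[OF continuous_t_norm])
         (use metric_in_unit[OF x x] Suc.prems in auto)
    then have *: "(\<lambda>n. T (?a n) (?b n)) \<longlonglongrightarrow> 1"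
      using right_unit[of 1] by simp
    have lower: "T (?a n) (?b n) \<le> M (x n) (x (n + Suc p)) \<rho>" for n
      using triangle[OF x x x, of "\<rho> / 2" "\<rho> / 2" n "n + p" "Suc (n + p)"] Suc.prems by simp
    have upper: "M (x n) (x (n + Suc p)) \<rho> \<le> 1" for n
      by (rule le_one[OF x x Suc.prems])
    show ?case
      by (rule tendsto_sandwich[OF always_eventually always_eventually * tendsto_const])
         (intro allI lower upper)+
  qed
  show ?thesis
    unfolding G_Cauchy_def
  proof (intro allI ballI impI)
    fix p :: nat and \<epsilon> \<rho> :: real
    assume "\<epsilon> \<in> {0<..<1}" "0 < \<rho>"
    then show "\<exists>N. \<forall>n\<ge>N. 1 - \<epsilon> < M (x n) (x (n + p)) \<rho>"
      using order_tendstoD(1)[OF conv[of \<rho> p], of "1 - \<epsilon>"]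
      by (simp add: eventually_sequentially)
  qed
qed

text \<open>
  Since \<open>u\<close> occurs arbitrarily late, the number \<open>M u l 1\<close> itself exceeds \<open>1 - \<epsilon>\<close> for every \<open>\<epsilon>\<close>. An
  alternating sequence can therefore converge only if its two values agree.
\<close>

lemma fm_converges_frequent_value:
  assumes conv: "fm_converges M x l" and "l \<in> X" "u \<in> X" and freq: "\<And>N. \<exists>n\<ge>N. x n = u"
  shows "l = u"
proof (rule ccontr)
  assume "l \<noteq> u"
  then have "M u l 1 \<noteq> 1"
    using eq_one_iff[of u l 1] assms by simp
  then have "1 - M u l 1 \<in> {0<..<1}"
    using positive[of u l 1] le_one[of u l 1] assms by simp
  then obtain N where "\<And>n. n \<ge> N \<Longrightarrow> M (x n) l 1 > 1 - (1 - M u l 1)"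
    using conv unfolding fm_converges_def by (meson zero_less_one)
  moreover obtain n where "n \<ge> N" "x n = u"
    using freq by blast
  ultimately show False
    by fastforce
qed

end

section \<open>G-completeness makes chain equivalence complete and separated\<close>

locale G_complete_fuzzy_metric_space = fuzzy_metric_space +
  assumes complete: "G_complete X M"
begin

text \<open>
  Only consecutive terms matter for being G-Cauchy. So inserting the intermediate points of the
  chains into \<open>x\<close> gives a G-Cauchy sequence, and \<open>x\<close> converges as a subsequence of it.
\<close>

lemma chained_sequence_converges:
  assumes x: "\<And>n. x n \<in> X" and chain: "\<And>n. chained_level n (x n) (x (Suc n))"
  obtains l where "l \<in> X" "fm_converges M x l"
proof -
  let ?R = "\<lambda>n u v. u \<in> X \<and> v \<in> X \<and> M u v (level n) > 1 - level n"
  have anti: "?R n a b" if "?R (Suc n) a b" for n a b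
    using that metric_mono[of a b "level (Suc n)" "level n"] level_antimono[of n "Suc n"]
      level_bounds[of "Suc n"] by auto
  obtain z and k :: "nat \<Rightarrow> nat" where k: "strict_mono k" and zk: "\<And>n. z (k n) = x n"
    and step: "\<And>n i. k n \<le> i \<Longrightarrow> ?R n (z i) (z (Suc i))"
    by (rule interpolate_chains[of ?R x])
       (use chain anti x level_bounds in \<open>auto simp: chained_level_def chained_def metric_refl\<close>)
  \<comment> \<open>The interpolation is controlled only from position \<open>k 0\<close> on, so it is shifted to start there.\<close>
  define y where "y i = z (k 0 + i)" for i
  have y: "y i \<in> X" for i
    using step[of 0 "k 0 + i"] by (simp add: y_def)
  have "(\<lambda>i. M (y i) (y (Suc i)) \<rho>) \<longlonglongrightarrow> 1" if "0 < \<rho>" for \<rho>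
  proof (rule order_tendstoI)
    fix a :: real
    assume "1 < a"
    then show "\<forall>\<^sub>F i in sequentially. M (y i) (y (Suc i)) \<rho> < a"
      using le_one[OF y y that] by (intro always_eventually allI) (meson le_less_trans)
  next
    fix a :: real
    assume "a < 1"
    then have "\<forall>\<^sub>F n in sequentially. level n < \<rho> \<and> level n < 1 - a"
      using that by (intro eventually_conj level_eventually_less) auto
    then obtain n where n: "level n < \<rho>" "level n < 1 - a"
      by (auto simp: eventually_sequentially)
    have "M (y i) (y (Suc i)) \<rho> > a" if "i \<ge> k n" for i
      using step[of n "k 0 + i"] metric_mono[OF y y level_bounds(1), of n \<rho> i "Suc i"] n that
      by (simp add: y_def)
    then show "\<forall>\<^sub>F i in sequentially. a < M (y i) (y (Suc i)) \<rho>"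
      by (auto simp: eventually_sequentially)
  qed
  then have "G_Cauchy M y"
    by (rule G_Cauchy_of_consecutive[OF y])
  then obtain l where l: "l \<in> X" "fm_converges M y l"
    using complete y unfolding G_complete_def by blast
  have yx: "y (k n - k 0) = x n" for n
    using k zk[of n] by (simp add: y_def strict_mono_less_eq)
  have "fm_converges M x l"
    unfolding fm_converges_def
  proof (intro ballI allI impI)
    fix \<epsilon> \<rho> :: real
    assume "\<epsilon> \<in> {0<..<1}" "0 < \<rho>"
    then obtain N where N: "\<And>i. i \<ge> N \<Longrightarrow> M (y i) l \<rho> > 1 - \<epsilon>"
      using l(2) unfolding fm_converges_def by blast
    have "M (x n) l \<rho> > 1 - \<epsilon>" if "n \<ge> k 0 + N" for n
      using N[of "k n - k 0"] strict_mono_imp_increasing[OF k, of n] that yx[of n] by simp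
    then show "\<exists>N. \<forall>n\<ge>N. M (x n) l \<rho> > 1 - \<epsilon>"
      by blast
  qed
  then show thesis
    using l(1) that by blast
qed

text \<open>
  If \<open>u\<close> and \<open>v\<close> were distinct but chained at every level, the sequence \<open>u, v, u, v, \<dots>\<close> would
  satisfy the hypothesis of the preceding lemma without having a limit.
\<close>

lemma chained_separated:
  assumes "u \<in> X" "v \<in> X" and chain: "\<And>n. chained_level n u v"
  shows "u = v"
proof -
  define x where "x n = (if even n then u else v)" for n :: nat
  obtain l where l: "l \<in> X" "fm_converges M x l"
    by (rule chained_sequence_converges[of x])
       (use assms chained_level_sym in \<open>auto simp: x_def\<close>)
  have "\<exists>n\<ge>N. x n = u" "\<exists>n\<ge>N. x n = v" for N
    by (intro exI[of _ "2 * N"] exI[of _ "Suc (2 * N)"]; simp add: x_def)+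
  then have "l = u" "l = v"
    using fm_converges_frequent_value[OF l(2,1)] assms by blast+
  then show ?thesis by simp
qed

end

section \<open>Near-fixed points of a multi-valued contraction\<close>

locale multivalued_contraction = G_complete_fuzzy_metric_space X M T
  for X :: "'a set" and M T +
  fixes \<zeta> :: "real \<Rightarrow> real" and S :: "'a \<Rightarrow> 'a set"
  assumes far: "u \<in> X \<Longrightarrow> v \<in> X \<Longrightarrow> ((\<lambda>\<rho>. M u v \<rho>) \<longlongrightarrow> 1) at_top"
    and gauge: "\<zeta> \<in> Pi_class"
    and compact_values: "u \<in> X \<Longrightarrow> S u \<in> fm_compacts X M"
    and contraction: "zeta_contraction X M \<zeta> S"
begin

definition near_fixed :: "real \<Rightarrow> real \<Rightarrow> 'a set" where
  "near_fixed b s = {p \<in> X. \<exists>q\<in>S p. chained b s p q}"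

lemma near_fixed_mono: "0 < s \<Longrightarrow> s \<le> r \<Longrightarrow> c \<le> b \<Longrightarrow> near_fixed b s \<subseteq> near_fixed c r"
  by (auto simp: near_fixed_def intro: chained_mono)

lemma zeta_pos: "0 < \<rho> \<Longrightarrow> 0 < \<zeta> \<rho>"
  using gauge by (simp add: Pi_class_def)

lemma zeta_iter_pos: "0 < \<rho> \<Longrightarrow> 0 < (\<zeta> ^^ n) \<rho>"
  by (induction n) (auto simp: zeta_pos)

lemma zeta_iter_less: "0 < \<rho> \<Longrightarrow> 0 < s \<Longrightarrow> \<forall>\<^sub>F n in sequentially. (\<zeta> ^^ n) \<rho> < s"
  using gauge by (intro order_tendstoD(2)[where y = 0]) (auto simp: Pi_class_def)

lemma zeta_small:
  assumes "0 < s"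
  obtains r where "0 < r" "r < s" "\<zeta> r < s"
proof -
  obtain N where N: "\<And>n. n \<ge> N \<Longrightarrow> (\<zeta> ^^ n) 1 < s"
    using zeta_iter_less[OF zero_less_one assms] by (auto simp: eventually_sequentially)
  show thesis
    by (rule that[of "(\<zeta> ^^ N) 1"]) (use N[of N] N[of "Suc N"] zeta_iter_pos in auto)
qed

lemma values_nonempty: "u \<in> X \<Longrightarrow> S u \<noteq> {}"
  using compact_values by (simp add: fm_compacts_def)

lemma values_compact: "u \<in> X \<Longrightarrow> compactin (fm_topology X M) (S u)"
  using compact_values by (simp add: fm_compacts_def)

lemma values_subset: "u \<in> X \<Longrightarrow> S u \<subseteq> X"
  using compactin_subset_topspace[OF values_compact] topspace_fm_topology by simp

text \<open>
  The strict inequality with \<open>b\<close> passes through the infimum and the supremum in the Hausdorff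
  fuzzy metric, so that a witness exists whether or not the supremum is attained.
\<close>

lemma contraction_step:
  assumes u: "u \<in> X" and v: "v \<in> X" and "0 < \<rho>" and M: "M u v \<rho> > b" and x: "x \<in> S u"
  shows "\<exists>y\<in>S v. M x y (\<zeta> \<rho>) > b"
proof -
  have pos: "0 < \<zeta> \<rho>"
    using zeta_pos \<open>0 < \<rho>\<close> by simp
  have bdd: "bdd_above ((\<lambda>y. M x' y (\<zeta> \<rho>)) ` S v)" if "x' \<in> S u" for x'
    using le_one[OF _ _ pos] that values_subset[OF u] values_subset[OF v]
    by (intro bdd_aboveI2[of _ _ 1]) blast
  have "0 \<le> fm_point_set M x' (S v) (\<zeta> \<rho>)" if x': "x' \<in> S u" for x'
  proof -
    obtain y where y: "y \<in> S v"
      using values_nonempty[OF v] by blast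
    have "0 \<le> M x' y (\<zeta> \<rho>)"
      using positive[OF _ _ pos, of x' y] x' y values_subset[OF u] values_subset[OF v] by fastforce
    also have "\<dots> \<le> fm_point_set M x' (S v) (\<zeta> \<rho>)"
      unfolding fm_point_set_def by (rule cSUP_upper[OF y bdd[OF x']])
    finally show ?thesis .
  qed
  then have "bdd_below ((\<lambda>x. fm_point_set M x (S v) (\<zeta> \<rho>)) ` S u)"
    by (intro bdd_belowI2[of _ 0])
  then have "(INF x\<in>S u. fm_point_set M x (S v) (\<zeta> \<rho>)) \<le> fm_point_set M x (S v) (\<zeta> \<rho>)"
    using x by (rule cINF_lower)
  moreover have "M u v \<rho> \<le> fm_Hausdorff M (S u) (S v) (\<zeta> \<rho>)"
    using contraction u v \<open>0 < \<rho>\<close> by (simp add: zeta_contraction_def)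
  ultimately have "b < (SUP y\<in>S v. M x y (\<zeta> \<rho>))"
    using M by (simp add: fm_Hausdorff_def fm_point_set_def)
  then show ?thesis
    using less_cSUP_iff[OF values_nonempty[OF v] bdd[OF x]] by simp
qed

lemma chained_contraction:
  assumes "chained b \<rho> u v" "u \<in> X" "0 < \<rho>" "x \<in> S u"
  shows "\<exists>y\<in>S v. chained b (\<zeta> \<rho>) x y"
  using assms(1) unfolding chained_def
proof (induction rule: rtranclp_induct)
  case base
  then show ?case using assms by blast
next
  case (step v w)
  then obtain y where y: "y \<in> S v" "chained b (\<zeta> \<rho>) x y"
    unfolding chained_def by blast
  obtain y' where "y' \<in> S w" "M y y' (\<zeta> \<rho>) > b"
    using contraction_step[of v w \<rho> b y] step(2) y assms(3) by blast
  then have "y' \<in> S w" "chained b (\<zeta> \<rho>) y y'"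
    using y step(2) values_subset by (auto intro!: chained_step)
  then show ?case
    using chained_trans[OF y(2)] unfolding chained_def by blast
qed

lemma chained_at_some_scale:
  assumes "u \<in> X" "v \<in> X" "b < 1"
  obtains \<rho> where "0 < \<rho>" "chained b \<rho> u v"
proof -
  have "\<forall>\<^sub>F \<rho> in at_top. M u v \<rho> > b \<and> \<rho> > 0"
    using order_tendstoD(1)[OF far[OF assms(1,2)] assms(3)] eventually_gt_at_top
    by (rule eventually_conj)
  then obtain \<rho> where "M u v \<rho> > b" "\<rho> > 0"
    by (auto simp: eventually_at_top_linorder)
  then show thesis
    using that chained_step assms by blast
qed

text \<open>
  With the threshold \<open>b\<close> fixed, an orbit \<open>p, q, \<dots>\<close> can be followed along which consecutive points
  are chained at the scales \<open>\<rho>, \<zeta> \<rho>, \<zeta>\<^sup>2 \<rho>, \<dots>\<close>. The starting scale \<open>\<rho>\<close> exists because \<open>M\<close> tends to 1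
  at infinity.
\<close>

lemma near_fixed_nonempty:
  assumes "b < 1" "0 < s"
  shows "near_fixed b s \<noteq> {}"
proof -
  obtain u where u: "u \<in> X"
    using nonempty by blast
  obtain v where v: "v \<in> S u"
    using values_nonempty[OF u] by blast
  obtain \<rho> where \<rho>: "0 < \<rho>" "chained b \<rho> u v"
    using chained_at_some_scale[OF u _ assms(1)] values_subset[OF u] v by blast
  have "near_fixed b ((\<zeta> ^^ n) \<rho>) \<noteq> {}" for n
  proof (induction n)
    case 0
    then show ?case using u v \<rho> by (auto simp: near_fixed_def)
  next
    case (Suc n)
    then obtain p q where p: "p \<in> X" "q \<in> S p" "chained b ((\<zeta> ^^ n) \<rho>) p q"
      by (auto simp: near_fixed_def)
    then obtain q' where "q' \<in> S q" "chained b (\<zeta> ((\<zeta> ^^ n) \<rho>)) q q'"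
      using chained_contraction[OF p(3,1) zeta_iter_pos[OF \<rho>(1)] p(2)] by blast
    then show ?case
      using p values_subset by (auto simp: near_fixed_def)
  qed
  moreover obtain n where "(\<zeta> ^^ n) \<rho> < s"
    using zeta_iter_less[OF \<rho>(1) assms(2)] by (auto simp: eventually_sequentially)
  ultimately show ?thesis
    using near_fixed_mono[of "(\<zeta> ^^ n) \<rho>" s b b] zeta_iter_pos[OF \<rho>(1)] by force
qed

text \<open>
  Suppose \<open>u\<close> is chained to \<open>p\<close> at a scale \<open>r > c\<close>. Moving both points by \<open>S\<close> costs at most the
  scale \<open>c\<close>, and their images are chained at scale \<open>\<zeta> r\<close>. As chains compose without adding up
  scales, \<open>u\<close> is chained to \<open>p\<close> at scale \<open>max c (\<zeta> r)\<close>. Iterating \<open>\<zeta>\<close> brings the scale down to \<open>c\<close>,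
  even if \<open>\<zeta>\<close> raises it in between. Hence \<open>c\<close> bounds all near-fixed
  points at once, although the initial scale depends on \<open>p\<close>.
\<close>

lemma near_fixed_bounded:
  assumes u: "u \<in> X" and near: "\<And>x. x \<in> S u \<Longrightarrow> chained b c u x"
    and p: "p \<in> near_fixed b c" and "b < 1" "0 < c"
  shows "chained b c u p"
proof -
  obtain q where q: "p \<in> X" "q \<in> S p" "chained b c p q"
    using p by (auto simp: near_fixed_def)
  obtain \<rho> where \<rho>: "0 < \<rho>" "chained b \<rho> u p"
    using chained_at_some_scale[OF u q(1) \<open>b < 1\<close>] .
  have "chained b (max c ((\<zeta> ^^ n) \<rho>)) u p" for n
  proof (induction n)
    case 0
    then show ?case using chained_mono[OF \<rho>(2,1)] by simp
  next
    case (Suc n)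
    let ?r = "(\<zeta> ^^ n) \<rho>"
    let ?t = "max c (\<zeta> ?r)"
    have r: "0 < ?r" "0 < \<zeta> ?r"
      using zeta_iter_pos[OF \<rho>(1)] zeta_pos by auto
    show ?case
    proof (cases "?r \<le> c")
      case True
      then show ?thesis
        using Suc chained_mono[of b c u p ?t b] \<open>0 < c\<close> by (simp add: max_absorb1)
    next
      case False
      then have "chained b ?r p u"
        using Suc chained_sym[OF r(1)] by (simp add: max_absorb2)
      then obtain x where x: "x \<in> S u" "chained b (\<zeta> ?r) q x"
        using chained_contraction[OF _ q(1) r(1) q(2)] by blast
      have "chained b ?t p q" "chained b ?t q x" "chained b ?t u x"
        using chained_mono[OF q(3) \<open>0 < c\<close>] chained_mono[OF x(2) r(2)]
          chained_mono[OF near[OF x(1)] \<open>0 < c\<close>] by auto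
      then have "chained b ?t u p"
        using chained_trans chained_sym[of ?t b] \<open>0 < c\<close> by (meson less_max_iff_disj)
      then show ?thesis by simp
    qed
  qed
  moreover obtain n where "(\<zeta> ^^ n) \<rho> < c"
    using zeta_iter_less[OF \<rho>(1) \<open>0 < c\<close>] by (auto simp: eventually_sequentially)
  ultimately show ?thesis
    by (metis max.absorb1 less_imp_le)
qed

text \<open>
  The threshold stays fixed and only the scale varies, since the contraction changes the scale alone.
\<close>

definition chain_precompact :: "real \<Rightarrow> 'a set \<Rightarrow> bool" where
  "chain_precompact b A \<longleftrightarrow>
     A \<subseteq> X \<and> (\<forall>\<rho>>0. \<exists>F. finite F \<and> F \<subseteq> A \<and> (\<forall>x\<in>A. \<exists>y\<in>F. chained b \<rho> y x))"

lemma chain_precompact_subset: "chain_precompact b A \<Longrightarrow> A \<subseteq> X"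
  by (simp add: chain_precompact_def)

lemma chain_precompact_net:
  assumes "chain_precompact b A" "0 < \<rho>"
  obtains F where "finite F" "F \<subseteq> A" "\<And>x. x \<in> A \<Longrightarrow> \<exists>y\<in>F. chained b \<rho> y x"
  using assms unfolding chain_precompact_def by meson

lemma chain_precompact_cover:
  assumes "chain_precompact b A" "0 < \<rho>"
  shows "\<exists>F. finite F \<and> (\<forall>a\<in>A. \<forall>p. chained b \<rho> a p \<longrightarrow> (\<exists>y\<in>F. chained b \<rho> y p))"
proof -
  obtain F where F: "finite F" "F \<subseteq> A" "\<And>x. x \<in> A \<Longrightarrow> \<exists>y\<in>F. chained b \<rho> y x"
    by (rule chain_precompact_net[OF assms]) (rule that)
  have "\<exists>y\<in>F. chained b \<rho> y p" if "a \<in> A" "chained b \<rho> a p" for a p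
    using F(3)[OF that(1)] chained_trans[OF _ that(2)] by blast
  then show ?thesis
    using F(1) by blast
qed

text \<open>
  Take a net of \<open>A\<close> at a scale \<open>r\<close> with \<open>\<zeta> r < \<rho>\<close>. By contraction \<open>S\<close> maps \<open>A\<close> close to the values of
  \<open>S\<close> at the finitely many points of the net, and each of these values is compact.
\<close>

lemma chain_precompact_image:
  assumes A: "chain_precompact b A" and b: "b \<in> {0<..<1}"
  shows "chain_precompact b (\<Union>a\<in>A. S a)"
  unfolding chain_precompact_def
proof (intro conjI allI impI)
  have AX: "A \<subseteq> X"
    using A by (rule chain_precompact_subset)
  then show "(\<Union>a\<in>A. S a) \<subseteq> X"
    using values_subset by blast
  fix \<rho> :: real
  assume "0 < \<rho>"
  then obtain r where r: "0 < r" "\<zeta> r < \<rho>"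
    using zeta_small by metis
  obtain F where F: "finite F" "F \<subseteq> A" "\<And>x. x \<in> A \<Longrightarrow> \<exists>y\<in>F. chained b r y x"
    by (rule chain_precompact_net[OF A r(1)]) (rule that)
  have "\<forall>a\<in>A. \<exists>G. finite G \<and> G \<subseteq> S a \<and> (\<forall>x\<in>S a. \<exists>y\<in>G. chained b \<rho> y x)"
    using AX compactin_chained_net[OF values_compact b \<open>0 < \<rho>\<close>] by (simp add: subset_iff)
  then obtain G where G: "\<And>a. a \<in> A \<Longrightarrow> finite (G a)" "\<And>a. a \<in> A \<Longrightarrow> G a \<subseteq> S a"
      "\<And>a x. a \<in> A \<Longrightarrow> x \<in> S a \<Longrightarrow> \<exists>y\<in>G a. chained b \<rho> y x"
    by metis
  have "\<exists>y\<in>\<Union>a\<in>F. G a. chained b \<rho> y x" if a: "a \<in> A" and x: "x \<in> S a" for a x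
  proof -
    obtain a' where a': "a' \<in> F" "chained b r a' a"
      using F(3)[OF a] by blast
    then obtain x' where x': "x' \<in> S a'" "chained b (\<zeta> r) x x'"
      using chained_contraction[OF chained_sym[OF r(1) a'(2)] _ r(1) x] a AX by blast
    have "chained b \<rho> x' x"
      using chained_sym[OF \<open>0 < \<rho>\<close>] chained_mono[OF x'(2) zeta_pos[OF r(1)]] r(2) by simp
    moreover obtain y where "y \<in> G a'" "chained b \<rho> y x'"
      using G(3)[of a' x'] a'(1) x'(1) F(2) by blast
    ultimately show ?thesis
      using a'(1) chained_trans by blast
  qed
  moreover have "finite (\<Union>a\<in>F. G a)" "(\<Union>a\<in>F. G a) \<subseteq> (\<Union>a\<in>A. S a)"
    using F(1,2) G(1,2) by (auto, blast)
  ultimately show "\<exists>F. finite F \<and> F \<subseteq> (\<Union>a\<in>A. S a) \<and> (\<forall>x\<in>\<Union>a\<in>A. S a. \<exists>y\<in>F. chained b \<rho> y x)"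
    by blast
qed

text \<open>
  If a near-fixed point \<open>p\<close> is chained to \<open>A\<close> at scale \<open>\<rho>\<close>, then it is chained to the image of \<open>A\<close> at
  scale \<open>max (\<zeta> \<rho>) s\<close>, because \<open>p\<close> is chained at scale \<open>s\<close> to a point of \<open>S p\<close>. After finitely many
  images, the same number for all \<open>p\<close>, the scale is \<open>s\<close>, and a net of the precompact image is a net
  of these near-fixed points.
\<close>

lemma near_fixed_net_of_precompact:
  assumes b: "b \<in> {0<..<1}" and "0 < s"
    and "chain_precompact b A" "0 < \<rho>" "(\<zeta> ^^ n) \<rho> \<le> s"
  shows "\<exists>F. finite F \<and> (\<forall>p\<in>near_fixed b s. \<forall>a\<in>A. chained b (max \<rho> s) a p \<longrightarrow>
    (\<exists>y\<in>F. chained b s y p))"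
  using assms(3-5)
proof (induction n arbitrary: A \<rho>)
  case 0
  have "max \<rho> s = s"
    using 0 by simp
  then show ?case
    using chain_precompact_cover[OF 0(1) \<open>0 < s\<close>] by auto
next
  case (Suc n)
  have zr: "0 < \<zeta> \<rho>"
    using zeta_pos Suc.prems(2) by simp
  let ?t = "max (\<zeta> \<rho>) s"
  show ?case
  proof (cases "\<rho> \<le> s")
    case True
    then have "max \<rho> s = s"
      by simp
    then show ?thesis
      using chain_precompact_cover[OF Suc.prems(1) \<open>0 < s\<close>] by auto
  next
    case False
    have "(\<zeta> ^^ n) (\<zeta> \<rho>) \<le> s"
      using Suc.prems(3) by (simp add: funpow_swap1)
    from Suc.IH[OF chain_precompact_image[OF Suc.prems(1) b] zr this]
    obtain F where F: "finite F" "\<And>p x. p \<in> near_fixed b s \<Longrightarrow> x \<in> (\<Union>a\<in>A. S a) \<Longrightarrow>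
        chained b ?t x p \<Longrightarrow> \<exists>y\<in>F. chained b s y p"
      by meson
    have "\<exists>x\<in>\<Union>a\<in>A. S a. chained b ?t x p"
      if p: "p \<in> near_fixed b s" and a: "a \<in> A" "chained b (max \<rho> s) a p" for p a
    proof -
      obtain q where q: "p \<in> X" "q \<in> S p" "chained b s p q"
        using p by (auto simp: near_fixed_def)
      have "chained b \<rho> p a"
        using a(2) False chained_sym[OF Suc.prems(2)] by (simp add: max_absorb1)
      then obtain x where x: "x \<in> S a" "chained b (\<zeta> \<rho>) q x"
        using chained_contraction[OF _ q(1) Suc.prems(2) q(2)] by blast
      have "chained b ?t p q" "chained b ?t q x"
        using chained_mono[OF q(3) \<open>0 < s\<close>] chained_mono[OF x(2) zr] by auto
      then have "chained b ?t x p"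
        using chained_trans chained_sym[of ?t b] \<open>0 < s\<close> by (meson less_max_iff_disj)
      then show ?thesis
        using x(1) a(1) by blast
    qed
    then show ?thesis
      using F by (intro exI[of _ F]) meson
  qed
qed

text \<open>
  By boundedness all near-fixed points are chained to one point \<open>u\<close> at one scale \<open>c\<close>. So the
  preceding lemma applies to the precompact set \<open>{u}\<close>.
\<close>

lemma near_fixed_finite_net:
  assumes b: "b \<in> {0<..<1}" and "0 < s"
  obtains F where "finite F" "\<And>p. p \<in> near_fixed b s \<Longrightarrow> \<exists>y\<in>F. chained b s y p"
proof -
  have b1: "b < 1" using b by simp
  obtain u where u: "u \<in> X"
    using nonempty by blast
  obtain F where F: "finite F" "F \<subseteq> S u" "\<And>x. x \<in> S u \<Longrightarrow> \<exists>y\<in>F. chained b s y x"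
    using compactin_chained_net[OF values_compact[OF u] b \<open>0 < s\<close>] by blast
  have "\<exists>\<rho>>0. chained b \<rho> u y" if "y \<in> F" for y
  proof -
    have "y \<in> X"
      using that F(2) values_subset[OF u] by blast
    then show ?thesis
      using chained_at_some_scale[OF u _ b1, of y] by blast
  qed
  then obtain f where f: "\<And>y. y \<in> F \<Longrightarrow> 0 < f y" "\<And>y. y \<in> F \<Longrightarrow> chained b (f y) u y"
    by metis
  \<comment> \<open>A scale at which \<open>u\<close> is chained to all of \<open>S u\<close>: first to the net \<open>F\<close>, then within the net.\<close>
  define c where "c = Max (insert s (f ` F))"
  have c: "s \<le> c" "\<And>y. y \<in> F \<Longrightarrow> f y \<le> c"
    using F(1) by (auto simp: c_def)
  have "chained b c u x" if x: "x \<in> S u" for x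
  proof -
    obtain y where y: "y \<in> F" "chained b s y x"
      using F(3)[OF x] by blast
    then have "chained b c u y" "chained b c y x"
      using chained_mono[OF f(2)[OF y(1)] f(1)[OF y(1)] c(2)[OF y(1)]]
        chained_mono[OF y(2) \<open>0 < s\<close> c(1)] by auto
    then show ?thesis by (rule chained_trans)
  qed
  moreover have "near_fixed b s \<subseteq> near_fixed b c"
    using near_fixed_mono[OF \<open>0 < s\<close> c(1)] by simp
  moreover have "0 < c"
    using \<open>0 < s\<close> c(1) by simp
  ultimately have bounded: "chained b c u p" if "p \<in> near_fixed b s" for p
    using near_fixed_bounded[OF u, of b c p] b1 that by blast
  obtain n where "(\<zeta> ^^ n) c < s"
    using zeta_iter_less[of c s] \<open>0 < s\<close> c(1) by (auto simp: eventually_sequentially)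
  moreover have "chain_precompact b {u}"
    using u unfolding chain_precompact_def
    by (intro conjI allI impI exI[of _ "{u}"]) auto
  ultimately obtain F' where F': "finite F'"
      "\<forall>p\<in>near_fixed b s. \<forall>a\<in>{u}. chained b (max c s) a p \<longrightarrow> (\<exists>y\<in>F'. chained b s y p)"
    using near_fixed_net_of_precompact[OF assms, of "{u}" c n] \<open>0 < s\<close> c(1) by auto
  then show thesis
    using that[of F'] bounded c(1) by (simp add: max_absorb1)
qed

text \<open>
  Start with a point \<open>p n\<close> near-fixed at each level \<open>n\<close>. All but finitely many of them are
  near-fixed at any given level, where they fall into finitely many chain classes. So there are
  decreasing infinite index sets \<open>I n\<close> whose points lie in one class of level \<open>n\<close>, and an index
  at least \<open>n\<close> taken from each \<open>I n\<close> gives the sequence.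
\<close>

lemma near_fixed_coherent_sequence:
  obtains x where "\<And>n. x n \<in> near_fixed (1 - level n) (level n)"
    "\<And>n. chained_level n (x n) (x (Suc n))"
proof -
  let ?N = "\<lambda>n. near_fixed (1 - level n) (level n)"
  have anti: "?N n \<subseteq> ?N m" if "m \<le> n" for m n
    using near_fixed_mono[of "level n" "level m"] level_bounds[of n] level_antimono[OF that] by simp
  have "\<exists>p. p \<in> ?N n" for n
    using near_fixed_nonempty[of "1 - level n" "level n"] level_bounds[of n] by auto
  then obtain p where p: "\<And>n. p n \<in> ?N n"
    by metis
  have refine: "\<exists>J\<subseteq>I. infinite J \<and> (\<forall>i\<in>J. \<forall>j\<in>J. chained_level n (p i) (p j))"
    if I: "infinite I" for I n
  proof -
    obtain F where F: "finite F" "\<And>q. q \<in> ?N n \<Longrightarrow> \<exists>y\<in>F. chained_level n y q"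
      using near_fixed_finite_net[of "1 - level n" "level n"] level_bounds[of n]
      unfolding chained_level_def by auto
    have fin: "finite (I \<inter> {..<n})"
      by simp
    have "infinite (I - {..<n})"
      using I by (simp add: Diff_infinite_finite)
    moreover have "I - {..<n} \<subseteq> (\<Union>y\<in>F. {i \<in> I. chained_level n y (p i)})"
    proof
      fix i
      assume i: "i \<in> I - {..<n}"
      then have "p i \<in> ?N n"
        using anti[of n i] p[of i] by auto
      then show "i \<in> (\<Union>y\<in>F. {i \<in> I. chained_level n y (p i)})"
        using F(2)[of "p i"] i by blast
    qed
    ultimately have "infinite (\<Union>y\<in>F. {i \<in> I. chained_level n y (p i)})"
      using finite_subset by blast
    then obtain y where "infinite {i \<in> I. chained_level n y (p i)}"
      using F(1) by blast
    moreover have "chained_level n (p i) (p j)"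
      if "chained_level n y (p i)" "chained_level n y (p j)" for i j
      using that chained_level_trans[OF chained_level_sym] by blast
    ultimately show ?thesis
      by (intro exI[of _ "{i \<in> I. chained_level n y (p i)}"]) simp
  qed
  define good where
    "good n J \<longleftrightarrow> infinite J \<and> (\<forall>i\<in>J. \<forall>j\<in>J. chained_level n (p i) (p j))" for n J
  have refine: "\<exists>J. good n J \<and> J \<subseteq> I" if "infinite I" for I n
    using refine[OF that, of n] unfolding good_def by blast
  have start: "\<exists>J. good 0 J"
    using refine[OF infinite_UNIV_nat] by blast
  have extend: "\<exists>J'. good (Suc n) J' \<and> J' \<subseteq> J" if "good n J" for n J
    using refine[of J "Suc n"] that unfolding good_def by blast
  obtain I where good: "\<And>n. good n (I n)" and dec: "\<And>n. I (Suc n) \<subseteq> I n"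
    using dependent_nat_choice[of good "\<lambda>_ J J'. J' \<subseteq> J", OF start extend] by blast
  have I: "infinite (I n)" "i \<in> I n \<Longrightarrow> j \<in> I n \<Longrightarrow> chained_level n (p i) (p j)" for n i j
    using good[of n] by (simp_all add: good_def)
  have "\<exists>i. i \<in> I n \<and> n \<le> i" for n
    using I(1)[of n] unfolding infinite_nat_iff_unbounded_le by blast
  then obtain k where k: "\<And>n. k n \<in> I n" "\<And>n. n \<le> k n"
    by metis
  show thesis
  proof (rule that[of "\<lambda>n. p (k n)"])
    show "p (k n) \<in> ?N n" for n
      using anti[OF k(2)] p by blast
    show "chained_level n (p (k n)) (p (k (Suc n)))" for n
      using I(2)[of "k n" n "k (Suc n)"] k(1)[of n] k(1)[of "Suc n"] dec[of n] by blast
  qed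
qed

text \<open>
  Passing from \<open>l\<close> to a late \<open>x n\<close>, on to a point of \<open>S (x n)\<close>, and back to a point of \<open>S l\<close> by
  contraction, costs three chains of level \<open>m\<close>, which compose to one.
\<close>

lemma limit_near_fixed:
  assumes x: "\<And>n. x n \<in> near_fixed (1 - level n) (level n)"
    and l: "l \<in> X" "fm_converges M x l"
  shows "l \<in> near_fixed (1 - level m) (level m)"
proof -
  let ?b = "1 - level m" and ?s = "level m"
  have xX: "x n \<in> X" for n
    using x[of n] by (simp add: near_fixed_def)
  obtain r where r: "0 < r" "r < ?s" "\<zeta> r < ?s"
    using zeta_small[OF level_bounds(1)] .
  obtain N where "\<And>n. n \<ge> N \<Longrightarrow> M (x n) l r > ?b"
    using l(2) level_bounds[of m] r(1) unfolding fm_converges_def by (meson greaterThanLessThan_iff)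
  then have "chained ?b r (x (max m N)) l"
    using xX l(1) by (intro chained_step) auto
  moreover obtain q where q: "q \<in> S (x (max m N))" "chained ?b ?s (x (max m N)) q"
    using x[of "max m N"] near_fixed_mono[of "level (max m N)" ?s ?b "1 - level (max m N)"]
      level_bounds level_antimono[of m "max m N"] by (auto simp: near_fixed_def)
  ultimately obtain y where y: "y \<in> S l" "chained ?b (\<zeta> r) q y"
    using chained_contraction[OF _ xX r(1)] by blast
  have "chained ?b ?s l (x (max m N))"
    using chained_mono[OF \<open>chained ?b r (x (max m N)) l\<close> r(1)] r(2) chained_sym level_bounds
    by (meson less_imp_le order_refl)
  moreover have "chained ?b ?s q y"
    using chained_mono[OF y(2) zeta_pos[OF r(1)]] r(3) by simp
  ultimately have "chained ?b ?s l y"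
    using q(2) chained_trans by blast
  then show ?thesis
    using l(1) y(1) by (auto simp: near_fixed_def)
qed

text \<open>
  If \<open>l \<notin> S l\<close>, separation by chains covers \<open>S l\<close> by the increasing open sets of points not chained
  to \<open>l\<close> at level \<open>n\<close>. By compactness one of them covers \<open>S l\<close>, which contradicts near-fixedness at
  that level.
\<close>

lemma fixed_of_near_fixed:
  assumes near: "\<And>n. l \<in> near_fixed (1 - level n) (level n)"
  shows "l \<in> S l"
proof (rule ccontr)
  assume notin: "l \<notin> S l"
  have l: "l \<in> X"
    using near[of 0] by (simp add: near_fixed_def)
  let ?V = "\<lambda>n. {v \<in> X. \<not> chained_level n l v}"
  have "openin (fm_topology X M) (?V n)" for n
    unfolding chained_level_def
    by (rule openin_chained_class(2)) (use level_bounds[of n] in auto)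
  moreover have "S l \<subseteq> \<Union> (range ?V)"
    using chained_separated[OF l] notin values_subset[OF l] by blast
  ultimately obtain \<F> where \<F>: "finite \<F>" "\<F> \<subseteq> range ?V" "S l \<subseteq> \<Union> \<F>"
    using compactinD[OF values_compact[OF l], of "range ?V"] by blast
  obtain K where K: "finite K" "\<F> = ?V ` K"
    using finite_subset_image[OF \<F>(1,2)] by blast
  obtain n where n: "\<And>k. k \<in> K \<Longrightarrow> k \<le> n"
    using K(1) unfolding finite_nat_set_iff_bounded_le by blast
  obtain q where q: "q \<in> S l" "chained_level n l q"
    using near[of n] by (auto simp: near_fixed_def chained_level_def)
  then show False
    using \<F>(3) K(2) chained_level_mono[OF q(2)] n by blast
qed

lemma has_fixed_point: "\<exists>u\<in>X. u \<in> S u"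
proof -
  obtain x where x: "\<And>n. x n \<in> near_fixed (1 - level n) (level n)"
    and coherent: "\<And>n. chained_level n (x n) (x (Suc n))"
    by (rule near_fixed_coherent_sequence) (rule that)
  have "x n \<in> X" for n
    using x[of n] by (simp add: near_fixed_def)
  then obtain l where l: "l \<in> X" "fm_converges M x l"
    using chained_sequence_converges[OF _ coherent] by blast
  then show ?thesis
    using fixed_of_near_fixed limit_near_fixed[OF x] by blast
qed

end

section \<open>The fixed point theorem\<close>

theorem theorem15:
  fixes X :: "'a set"
    and M :: "'a \<Rightarrow> 'a \<Rightarrow> real \<Rightarrow> real"
    and T :: "real \<Rightarrow> real \<Rightarrow> real"
    and \<zeta> :: "real \<Rightarrow> real"
    and S :: "'a \<Rightarrow> 'a set"
  assumes "fuzzy_metric_space X M T"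
    and "G_complete X M"
    and "H_type T"
    and "\<And>u v. u \<in> X \<Longrightarrow> v \<in> X \<Longrightarrow> ((\<lambda>\<rho>. M u v \<rho>) \<longlongrightarrow> 1) at_top"
    and "\<zeta> \<in> Pi_class"
    and "\<And>u. u \<in> X \<Longrightarrow> S u \<in> fm_compacts X M"
    and "zeta_contraction X M \<zeta> S"
  shows "\<exists>u\<in>X. u \<in> S u"
proof -
  interpret fuzzy_metric_space X M T
    by fact
  interpret multivalued_contraction X M T \<zeta> S
    by unfold_locales (use assms in auto)
  show ?thesis
    by (rule has_fixed_point)
qed

end
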